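(* Let $f:G\to H$ be a continuous homomorphism of topological groups with $H$ Hausdorff. The following are equivalent: (i) $f$ is h-complete; (ii) every og-filter for $f$ has a cluster point in $G$; (iii) every maximal og-filter for $f$ converges in $G$.
   Context: Topological groups are not assumed to be Hausdorff unless stated. A continuous homomorphism $k:K\to H$ is (fibrewise) Hausdorff if any two distinct points of the same fibre of $k$ can be separated by disjoint open neighbourhoods in $K$. A continuous homomorphism $f:G\to H$ is h-complete if for every topological group $K$ and every factorization $f=k\cdot h$ into continuous homomorphisms $h:G\to K$, $k:K\to H$ with $k$ Hausdorff, the image $h(G)$ is closed in $K$. Filters are always proper (do not contain $\emptyset$), and $\mathcal N(x)$ denotes the set of open neighbourhoods of $x$. A filter $\mathcal F$ on $G$ is an og-filter for $f:G\to H$ if there exist a topological group $P$, continuous homomorphisms $r:P\to H$ and $\varphi:G\to P$, and a point $x\in P$ such that $f=r\cdot\varphi$ and $\{\varphi^{-1}(U) : U\in\mathcal N(x)\}$ is a base of $\mathcal F$. A maximal og-filter for $f$ is one that is maximal with respect to $\subseteq$ among the og-filters for $f$. *)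

theory Defs
  imports "HOL-Analysis.Analysis" "HOL-Algebra.Generated_Groups"
begin

section \<open>Topological groups and continuous homomorphisms\<close>

text \<open>No separation axiom is assumed, and the group need not be commutative.\<close>

locale topological_group = group G for G (structure) +
  fixes T :: "'a topology"
  assumes topspace_eq_carrier: "topspace T = carrier G"
    and continuous_mult: "continuous_map (prod_topology T T) T (\<lambda>(x, y). x \<otimes> y)"
    and continuous_inv: "continuous_map T T (\<lambda>x. inv x)"

definition continuous_hom ::
  "('a, 'm) monoid_scheme \<Rightarrow> 'a topology \<Rightarrow> ('b, 'n) monoid_scheme \<Rightarrow> 'b topology \<Rightarrow> ('a \<Rightarrow> 'b) \<Rightarrow> bool"
  where "continuous_hom G TG H TH f \<longleftrightarrow> f \<in> hom G H \<and> continuous_map TG TH f"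

definition fibrewise_Hausdorff :: "'a topology \<Rightarrow> ('a \<Rightarrow> 'b) \<Rightarrow> bool"
  where "fibrewise_Hausdorff T k \<longleftrightarrow>
    (\<forall>x\<in>topspace T. \<forall>y\<in>topspace T. x \<noteq> y \<and> k x = k y \<longrightarrow>
      (\<exists>U V. openin T U \<and> openin T V \<and> x \<in> U \<and> y \<in> V \<and> disjnt U V))"


section \<open>h-complete homomorphisms and og-filters\<close>

text \<open>
  Both notions quantify over all topological groups, and a HOL definition has to place their
  carriers in one fixed type. For a group \<open>G\<close> on the type \<open>'g\<close> the type \<open>('g + bool) list\<close> is
  large enough: given a homomorphism \<open>h\<close> from \<open>G\<close> to any group \<open>K\<close> and a point \<open>x\<close> of \<open>K\<close>, the
  subgroup generated by \<open>x\<close> and the image of \<open>h\<close> injects into it, each element being represented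
  by a word in the elements of \<open>G\<close> and two further letters for \<open>x\<close> and its inverse. The lemmas
  \<open>h_completeD\<close> and \<open>og_filterI\<close> below show that consequently neither notion depends on
  this choice: the defining properties hold for topological groups on arbitrary types.
\<close>

type_synonym 'g word = "('g + bool) list"

definition h_complete ::
  "('g, 'm) monoid_scheme \<Rightarrow> 'g topology \<Rightarrow> ('h, 'n) monoid_scheme \<Rightarrow> 'h topology \<Rightarrow> ('g \<Rightarrow> 'h) \<Rightarrow> bool"
  where "h_complete G TG H TH f \<longleftrightarrow>
    (\<forall>(K :: 'g word monoid) TK h k.
      topological_group K TK \<and> continuous_hom G TG K TK h \<and> continuous_hom K TK H TH k \<and>
      (\<forall>g\<in>carrier G. f g = k (h g)) \<and> fibrewise_Hausdorff TK k
      \<longrightarrow> closedin TK (h ` carrier G))"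

text \<open>
  A filter on the set \<open>carrier G\<close> is represented by the filter on the type \<open>'g\<close> that it generates,
  and \<open>A\<close> is a member of \<open>F\<close> iff \<open>\<forall>\<^sub>F g in F. g \<in> A\<close>. The filter \<open>bot\<close> is the improper one.
\<close>

definition og_filter ::
  "('g, 'm) monoid_scheme \<Rightarrow> 'g topology \<Rightarrow> ('h, 'n) monoid_scheme \<Rightarrow> 'h topology \<Rightarrow> ('g \<Rightarrow> 'h) \<Rightarrow>
   'g filter \<Rightarrow> bool"
  where "og_filter G TG H TH f F \<longleftrightarrow> F \<noteq> bot \<and>
    (\<exists>(P :: 'g word monoid) TP r \<phi>. \<exists>x\<in>carrier P.
      topological_group P TP \<and> continuous_hom P TP H TH r \<and> continuous_hom G TG P TP \<phi> \<and>
      (\<forall>g\<in>carrier G. f g = r (\<phi> g)) \<and>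
      (\<forall>A. (\<forall>\<^sub>F g in F. g \<in> A) \<longleftrightarrow>
        (\<exists>U. openin TP U \<and> x \<in> U \<and> {g \<in> carrier G. \<phi> g \<in> U} \<subseteq> A)))"

text \<open>
  The library's order on filters is the reverse of inclusion: \<open>F \<le> F'\<close> means that every member of
  \<open>F'\<close> is a member of \<open>F\<close>.
\<close>

definition maximal_og_filter ::
  "('g, 'm) monoid_scheme \<Rightarrow> 'g topology \<Rightarrow> ('h, 'n) monoid_scheme \<Rightarrow> 'h topology \<Rightarrow> ('g \<Rightarrow> 'h) \<Rightarrow>
   'g filter \<Rightarrow> bool"
  where "maximal_og_filter G TG H TH f F \<longleftrightarrow> og_filter G TG H TH f F \<and>
    (\<forall>F'. og_filter G TG H TH f F' \<and> F' \<le> F \<longrightarrow> F' = F)"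

definition cluster_point :: "'a topology \<Rightarrow> 'a filter \<Rightarrow> 'a \<Rightarrow> bool"
  where "cluster_point T F c \<longleftrightarrow> c \<in> topspace T \<and>
    (\<forall>U A. openin T U \<and> c \<in> U \<and> (\<forall>\<^sub>F x in F. x \<in> A) \<longrightarrow> U \<inter> A \<noteq> {})"

abbreviation filter_converges :: "'a topology \<Rightarrow> 'a filter \<Rightarrow> 'a \<Rightarrow> bool"
  where "filter_converges T F c \<equiv> limitin T (\<lambda>x. x) c F"


section \<open>Independence of the choice of carrier type\<close>

lemma topological_group_pullback:
  assumes K: "topological_group K TK" and Q: "group Q" and j: "j \<in> hom Q K"
  shows "topological_group Q (pullback_topology (carrier Q) j TK)"
    and "continuous_map (pullback_topology (carrier Q) j TK) TK j"
proof -
  let ?T = "pullback_topology (carrier Q) j TK"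
  interpret K: topological_group K TK by fact
  interpret Q: group Q by fact
  interpret gh: group_hom Q K j
    using j by (simp add: group_hom_def group_hom_axioms_def Q K.group_axioms)
  have top: "topspace ?T = carrier Q"
    using j by (auto simp: topspace_pullback_topology K.topspace_eq_carrier hom_def)
  have cj: "continuous_map ?T TK j"
    using continuous_map_pullback[OF continuous_map_id, of "carrier Q" j TK] by simp
  show "continuous_map ?T TK j" by fact
  have "continuous_map (prod_topology ?T ?T) TK ((\<lambda>(x, y). x \<otimes>\<^bsub>K\<^esub> y) \<circ> (\<lambda>(x, y). (j x, j y)))"
    by (rule continuous_map_compose[OF _ K.continuous_mult])
       (auto simp: continuous_map_prod_top cj)
  then have "continuous_map (prod_topology ?T ?T) TK (j \<circ> (\<lambda>(x, y). x \<otimes>\<^bsub>Q\<^esub> y))"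
    by (rule continuous_map_eq) (auto simp: top)
  then have m: "continuous_map (prod_topology ?T ?T) ?T (\<lambda>(x, y). x \<otimes>\<^bsub>Q\<^esub> y)"
    by (rule continuous_map_pullback') (auto simp: top)
  have "continuous_map ?T TK ((\<lambda>x. inv\<^bsub>K\<^esub> x) \<circ> j)"
    by (rule continuous_map_compose[OF cj K.continuous_inv])
  then have "continuous_map ?T TK (j \<circ> (\<lambda>x. inv\<^bsub>Q\<^esub> x))"
    by (rule continuous_map_eq) (auto simp: top)
  then have i: "continuous_map ?T ?T (\<lambda>x. inv\<^bsub>Q\<^esub> x)"
    by (rule continuous_map_pullback') (auto simp: top)
  show "topological_group Q ?T"
    using top m i by unfold_locales auto
qed

primrec eval_word :: "('k, 'n) monoid_scheme \<Rightarrow> ('g \<Rightarrow> 'k) \<Rightarrow> 'k \<Rightarrow> 'g word \<Rightarrow> 'k" where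
  "eval_word K h x [] = \<one>\<^bsub>K\<^esub>"
| "eval_word K h x (a # w) =
    (case a of Inl g \<Rightarrow> h g | Inr b \<Rightarrow> if b then x else inv\<^bsub>K\<^esub> x) \<otimes>\<^bsub>K\<^esub> eval_word K h x w"

lemma generate_words:
  assumes G: "group G" and K: "group K" and h: "h \<in> hom G K" and x: "x \<in> carrier K"
    and y: "y \<in> generate K (insert x (h ` carrier G))"
  shows "\<exists>w. set w \<subseteq> Inl ` carrier G \<union> range Inr \<and> eval_word K h x w = y"
  using y
proof (induction rule: generate.induct)
  interpret group_hom G K h
    using G K h by (simp add: group_hom_def group_hom_axioms_def)
  {
    case one
    show ?case by (rule exI[of _ "[]"]) simp
  next
    case (incl y)
    then show ?case
    proof
      assume "y = x"
      then show ?thesis by (intro exI[of _ "[Inr True]"]) (auto simp: x)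
    next
      assume "y \<in> h ` carrier G"
      then obtain g where "g \<in> carrier G" "y = h g" by blast
      then show ?thesis by (intro exI[of _ "[Inl g]"]) simp
    qed
  next
    case (inv y)
    then show ?case
    proof
      assume "y = x"
      then show ?thesis by (intro exI[of _ "[Inr False]"]) (auto simp: x)
    next
      assume "y \<in> h ` carrier G"
      then obtain g where "g \<in> carrier G" "y = h g" by blast
      then show ?thesis by (intro exI[of _ "[Inl (inv\<^bsub>G\<^esub> g)]"]) simp
    qed
  next
    case (eng y z)
    then obtain v w where vw:
      "set v \<subseteq> Inl ` carrier G \<union> range Inr" "eval_word K h x v = y"
      "set w \<subseteq> Inl ` carrier G \<union> range Inr" "eval_word K h x w = z" by blast
    have closed: "eval_word K h x u \<in> carrier K" if "set u \<subseteq> Inl ` carrier G \<union> range Inr" for u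
      using that x by (induction u) auto
    have "eval_word K h x (v @ w) = eval_word K h x v \<otimes>\<^bsub>K\<^esub> eval_word K h x w"
      using vw(1)
    proof (induction v)
      case Nil
      then show ?case using closed[OF vw(3)] by simp
    next
      case (Cons a v)
      have "(case a of Inl g \<Rightarrow> h g | Inr b \<Rightarrow> if b then x else inv\<^bsub>K\<^esub> x) \<in> carrier K"
        using Cons.prems x by auto
      then show ?case
        using Cons closed[OF vw(3)] closed[of v] by (simp add: H.m_assoc)
    qed
    then show ?case
      using vw by (intro exI[of _ "v @ w"]) auto
  }
qed

lemma word_model:
  fixes G :: "('g, 'm) monoid_scheme" and K :: "('k, 'n) monoid_scheme"
  assumes G: "topological_group G TG" and K: "topological_group K TK"
    and h: "continuous_hom G TG K TK h" and x: "x \<in> carrier K"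
  obtains Q :: "'g word monoid" and TQ and j and h' :: "'g \<Rightarrow> 'g word" and x'
  where "topological_group Q TQ" "TQ = pullback_topology (carrier Q) j TK"
    "continuous_hom Q TQ K TK j" "inj_on j (carrier Q)"
    "continuous_hom G TG Q TQ h'" "\<And>g. g \<in> carrier G \<Longrightarrow> j (h' g) = h g"
    "x' \<in> carrier Q" "j x' = x"
proof -
  interpret G: topological_group G TG by fact
  interpret K: topological_group K TK by fact
  have hom: "h \<in> hom G K" and ch: "continuous_map TG TK h"
    using h by (auto simp: continuous_hom_def)
  have hc: "h g \<in> carrier K" if "g \<in> carrier G" for g
    using hom that by (auto simp: hom_def)
  define S where "S = generate K (insert x (h ` carrier G))"
  have S: "subgroup S K"
    unfolding S_def by (rule K.generate_is_subgroup) (use x hc in auto)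
  interpret S: subgroup S K by fact
  define i :: "'k \<Rightarrow> 'g word" where "i y = (SOME w. eval_word K h x w = y)" for y
  have ev: "eval_word K h x (i y) = y" if "y \<in> S" for y
    unfolding i_def
    by (rule someI_ex)
       (use generate_words[OF G.group_axioms K.group_axioms hom x] that S_def in blast)
  define j where "j = eval_word K h x"
  have ji: "j (i y) = y" if "y \<in> S" for y using ev that by (simp add: j_def)
  define Q :: "'g word monoid" where
    "Q = \<lparr>carrier = i ` S, mult = (\<lambda>a b. i (j a \<otimes>\<^bsub>K\<^esub> j b)), one = i \<one>\<^bsub>K\<^esub>\<rparr>"
  have Q: "group Q"
  proof (rule groupI)
    fix a assume "a \<in> carrier Q"
    then obtain y where y: "y \<in> S" "a = i y" by (auto simp: Q_def)
    have "i (inv\<^bsub>K\<^esub> y) \<in> carrier Q" "i (inv\<^bsub>K\<^esub> y) \<otimes>\<^bsub>Q\<^esub> a = \<one>\<^bsub>Q\<^esub>"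
      using y by (auto simp: Q_def ji)
    then show "\<exists>b\<in>carrier Q. b \<otimes>\<^bsub>Q\<^esub> a = \<one>\<^bsub>Q\<^esub>" by blast
  qed (auto simp: Q_def ji K.m_assoc)
  have jhom: "j \<in> hom Q K"
    by (auto simp: hom_def Q_def ji)
  have inj: "inj_on j (carrier Q)"
    by (auto simp: inj_on_def Q_def ji)
  define TQ where "TQ = pullback_topology (carrier Q) j TK"
  have TQ: "topological_group Q TQ" "continuous_map TQ TK j"
    using topological_group_pullback[OF K Q jhom] by (auto simp: TQ_def)
  have xS: "x \<in> S" and hS: "\<And>g. g \<in> carrier G \<Longrightarrow> h g \<in> S"
    unfolding S_def by (auto intro: generate.incl)
  have "(i \<circ> h) \<in> hom G Q"
    using hom by (auto simp: hom_def Q_def ji hS)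
  moreover have "continuous_map TG TQ (i \<circ> h)"
    unfolding TQ_def
  proof (rule continuous_map_pullback')
    show "continuous_map TG TK (j \<circ> (i \<circ> h))"
      by (rule continuous_map_eq[OF ch]) (simp add: G.topspace_eq_carrier ji hS)
    show "topspace TG \<subseteq> (i \<circ> h) -` carrier Q"
      by (auto simp: G.topspace_eq_carrier Q_def hS)
  qed
  ultimately show ?thesis
    using that[of Q TQ j "i \<circ> h" "i x"] TQ jhom inj hS xS
    by (auto simp: continuous_hom_def ji TQ_def Q_def)
qed

lemma continuous_hom_compose:
  assumes "continuous_hom G TG K TK h" "continuous_hom K TK H TH k"
  shows "continuous_hom G TG H TH (k \<circ> h)"
  using assms
  by (auto simp: continuous_hom_def hom_def Pi_iff intro: continuous_map_compose)

lemma h_completeD: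
  fixes G :: "('g, 'm) monoid_scheme"
  assumes f: "h_complete G TG H TH f"
    and G: "topological_group G TG" and K: "topological_group K TK"
    and h: "continuous_hom G TG K TK h" and k: "continuous_hom K TK H TH k"
    and fkh: "\<And>g. g \<in> carrier G \<Longrightarrow> f g = k (h g)" and Hd: "fibrewise_Hausdorff TK k"
  shows "closedin TK (h ` carrier G)"
proof -
  interpret K: topological_group K TK by fact
  have hc: "h g \<in> carrier K" if "g \<in> carrier G" for g
    using h that by (auto simp: continuous_hom_def hom_def)
  have "x \<in> h ` carrier G" if x: "x \<in> TK closure_of (h ` carrier G)" for x
  proof -
    have "x \<in> carrier K"
      using x by (simp add: in_closure_of K.topspace_eq_carrier)
    from word_model[OF G K h this]
    obtain Q :: "'g word monoid" and TQ j h' x' where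
      Q: "topological_group Q TQ" and TQ: "TQ = pullback_topology (carrier Q) j TK"
      and j: "continuous_hom Q TQ K TK j" and inj: "inj_on j (carrier Q)"
      and h': "continuous_hom G TG Q TQ h'" and jh: "\<And>g. g \<in> carrier G \<Longrightarrow> j (h' g) = h g"
      and x': "x' \<in> carrier Q" "j x' = x"
      by metis
    interpret Q: topological_group Q TQ by fact
    have jK: "j a \<in> carrier K" if "a \<in> carrier Q" for a
      using j that by (auto simp: continuous_hom_def hom_def)
    have h'Q: "h' g \<in> carrier Q" if "g \<in> carrier G" for g
      using h' that by (auto simp: continuous_hom_def hom_def)
    have "fibrewise_Hausdorff TQ (k \<circ> j)"
      unfolding fibrewise_Hausdorff_def
    proof (intro ballI impI)
      fix a b assume ab: "a \<in> topspace TQ" "b \<in> topspace TQ" "a \<noteq> b \<and> (k \<circ> j) a = (k \<circ> j) b"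
      then have "j a \<noteq> j b" "k (j a) = k (j b)" "j a \<in> topspace TK" "j b \<in> topspace TK"
        using inj jK by (auto simp: inj_on_def Q.topspace_eq_carrier K.topspace_eq_carrier)
      then obtain U V where UV: "openin TK U" "openin TK V" "j a \<in> U" "j b \<in> V" "disjnt U V"
        using Hd unfolding fibrewise_Hausdorff_def by metis
      have "openin TQ (j -` U \<inter> carrier Q)" "openin TQ (j -` V \<inter> carrier Q)"
        using UV by (auto simp: TQ openin_pullback_topology)
      then show "\<exists>U V. openin TQ U \<and> openin TQ V \<and> a \<in> U \<and> b \<in> V \<and> disjnt U V"
        using UV ab
        by (intro exI[of _ "j -` U \<inter> carrier Q"] exI[of _ "j -` V \<inter> carrier Q"])
           (auto simp: Q.topspace_eq_carrier disjnt_iff)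
    qed
    then have "closedin TQ (h' ` carrier G)"
      using f Q h' continuous_hom_compose[OF j k] fkh jh unfolding h_complete_def
      by (metis comp_apply)
    then have "openin TQ (carrier Q - h' ` carrier G)"
      by (simp add: closedin_def Q.topspace_eq_carrier)
    then obtain V where V: "openin TK V" "carrier Q - h' ` carrier G = j -` V \<inter> carrier Q"
      by (auto simp: TQ openin_pullback_topology)
    show "x \<in> h ` carrier G"
    proof (rule ccontr)
      assume n: "x \<notin> h ` carrier G"
      have "x' \<notin> h' ` carrier G"
      proof
        assume "x' \<in> h' ` carrier G"
        then obtain g where "g \<in> carrier G" "x' = h' g" by blast
        with n x' jh[of g] show False by auto
      qed
      then have "x \<in> V" using V x' by blast
      then obtain g where g: "g \<in> carrier G" "h g \<in> V"
        using x V(1) by (auto simp: in_closure_of)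
      then have "h' g \<in> carrier Q - h' ` carrier G"
        using V jh h'Q by auto
      with g show False by blast
    qed
  qed
  then have "TK closure_of (h ` carrier G) \<subseteq> h ` carrier G" by blast
  moreover have "h ` carrier G \<subseteq> topspace TK"
    using hc by (auto simp: K.topspace_eq_carrier)
  ultimately show ?thesis
    using closure_of_subset_eq by blast
qed

lemma og_filterI:
  fixes G :: "('g, 'm) monoid_scheme"
  assumes G: "topological_group G TG" and P: "topological_group P TP"
    and r: "continuous_hom P TP H TH r" and \<phi>: "continuous_hom G TG P TP \<phi>"
    and fr: "\<And>g. g \<in> carrier G \<Longrightarrow> f g = r (\<phi> g)" and x: "x \<in> carrier P"
    and F: "F \<noteq> bot"
      "\<And>A. (\<forall>\<^sub>F g in F. g \<in> A) \<longleftrightarrow> (\<exists>U. openin TP U \<and> x \<in> U \<and> {g \<in> carrier G. \<phi> g \<in> U} \<subseteq> A)"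
  shows "og_filter G TG H TH f F"
proof -
  from word_model[OF G P \<phi> x]
  obtain Q :: "'g word monoid" and TQ j \<phi>' x' where
    Q: "topological_group Q TQ" and TQ: "TQ = pullback_topology (carrier Q) j TP"
    and j: "continuous_hom Q TQ P TP j"
    and \<phi>': "continuous_hom G TG Q TQ \<phi>'" and j\<phi>: "\<And>g. g \<in> carrier G \<Longrightarrow> j (\<phi>' g) = \<phi> g"
    and x': "x' \<in> carrier Q" "j x' = x"
    by metis
  have \<phi>'Q: "\<phi>' g \<in> carrier Q" if "g \<in> carrier G" for g
    using \<phi>' that by (auto simp: continuous_hom_def hom_def)
  have eq: "{g \<in> carrier G. \<phi>' g \<in> j -` U \<inter> carrier Q} = {g \<in> carrier G. \<phi> g \<in> U}" for U
    using \<phi>'Q j\<phi> by auto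
  have "(\<forall>\<^sub>F g in F. g \<in> A) \<longleftrightarrow> (\<exists>U. openin TQ U \<and> x' \<in> U \<and> {g \<in> carrier G. \<phi>' g \<in> U} \<subseteq> A)" for A
  proof
    assume "\<forall>\<^sub>F g in F. g \<in> A"
    then obtain U where "openin TP U" "x \<in> U" "{g \<in> carrier G. \<phi> g \<in> U} \<subseteq> A"
      using F(2) by blast
    then show "\<exists>U. openin TQ U \<and> x' \<in> U \<and> {g \<in> carrier G. \<phi>' g \<in> U} \<subseteq> A"
      using x' eq[of U]
      by (intro exI[of _ "j -` U \<inter> carrier Q"]) (auto simp: TQ openin_pullback_topology)
  next
    assume "\<exists>U. openin TQ U \<and> x' \<in> U \<and> {g \<in> carrier G. \<phi>' g \<in> U} \<subseteq> A"
    then obtain U where "openin TP U" "x' \<in> j -` U \<inter> carrier Q"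
      "{g \<in> carrier G. \<phi>' g \<in> j -` U \<inter> carrier Q} \<subseteq> A"
      by (auto simp: TQ openin_pullback_topology)
    then show "\<forall>\<^sub>F g in F. g \<in> A"
      using F(2) eq x' by auto
  qed
  moreover have "\<forall>g\<in>carrier G. f g = (r \<circ> j) (\<phi>' g)"
    using fr j\<phi> by simp
  ultimately show ?thesis
    using F(1) Q \<phi>' x'(1) continuous_hom_compose[OF j r] unfolding og_filter_def by blast
qed

end

theory Submission
  imports Defs "HOL-Algebra.Product_Groups"
begin

text \<open>An og-filter is the trace on \<open>G\<close> of the neighbourhoods of a point
  \<open>x\<close> in a group \<open>P\<close> over \<open>H\<close>, and such a trace is proper
  exactly when \<open>x\<close> is in the closure of the image of \<open>G\<close>
  (\<open>trace_filter_nontrivial_iff\<close>). So og-filters record how images of \<open>G\<close>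
  may fail to be closed.

  From h-completeness to cluster points (\<open>h_complete_closure_point\<close>): \<open>P\<close>
  need not be fibrewise Hausdorff over \<open>H\<close>, but its quotient by the closure
  \<open>N\<close> of the trivial subgroup is Hausdorff, and the map to \<open>H\<close> factors
  through it because points of \<open>H\<close> are closed. The image of \<open>G\<close> in the
  quotient is then closed, so the coset of \<open>x\<close> contains some \<open>\<phi> g\<close>.
  Points of one coset of \<open>N\<close> have the same neighbourhoods, so \<open>g\<close> lies in
  every member of the filter.

  Conversely (\<open>h_complete_iff_og_filters_cluster\<close>), let \<open>y\<close> be in the
  closure of the image of \<open>G\<close> in a fibrewise Hausdorff \<open>K\<close>, and
  \<open>c\<close> a cluster point of the trace of \<open>y\<close>. Along the common refinement of
  this trace with the neighbourhood filter of \<open>c\<close>, the map \<open>f\<close> tends to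
  both \<open>k y\<close> and \<open>f c\<close>, so \<open>h c\<close> and \<open>y\<close> lie in
  one fibre; no disjoint neighbourhoods separate them, hence \<open>h c = y\<close>.

  Cluster points and limits are related by \<open>og_filter_Inf\<close>: a nonempty family of
  og-filters with proper infimum (in the library's order, where finer is smaller) has an og-filter
  as infimum, realised in a fibre product over \<open>H\<close>. Neighbourhood filters of points of
  \<open>G\<close> are og-filters, so a maximal og-filter with a cluster point absorbs the
  neighbourhood filter of that point and converges. By Zorn's lemma each og-filter has a maximal
  refinement (\<open>ex_maximal_og_filter_le\<close>), and a limit of the refinement is a cluster
  point of the original.\<close>

section \<open>Topological groups\<close>

context topological_group
begin

lemma continuous_map_mult:
  assumes "continuous_map X T u" "continuous_map X T v"
  shows "continuous_map X T (\<lambda>x. u x \<otimes> v x)"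
  using continuous_map_compose[OF continuous_map_pairedI[OF assms] continuous_mult]
  by (simp add: comp_def)

lemma continuous_map_inv:
  assumes "continuous_map X T u"
  shows "continuous_map X T (\<lambda>x. inv (u x))"
  using continuous_map_compose[OF assms continuous_inv] by (simp add: comp_def)

lemma continuous_map_lmult: "a \<in> carrier G \<Longrightarrow> continuous_map T T (\<lambda>x. a \<otimes> x)"
  by (intro continuous_map_mult) (auto simp: topspace_eq_carrier)

lemma continuous_map_rmult: "a \<in> carrier G \<Longrightarrow> continuous_map T T (\<lambda>x. x \<otimes> a)"
  by (intro continuous_map_mult) (auto simp: topspace_eq_carrier)

lemma closure_of_subset_carrier: "T closure_of S \<subseteq> carrier G"
  using closure_of_subset_topspace[of T S] by (simp add: topspace_eq_carrier)

text \<open>Closure commutes with products, so continuity of multiplication carries the product of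
  two closures into the closure of \<open>S\<close>.\<close>

lemma subgroup_closure_of:
  assumes "subgroup S G"
  shows "subgroup (T closure_of S) G"
proof (rule subgroupI)
  interpret S: subgroup S G by fact
  show "T closure_of S \<subseteq> carrier G" by (rule closure_of_subset_carrier)
  have "S \<subseteq> T closure_of S"
    by (rule closure_of_subset) (use S.subset in \<open>simp add: topspace_eq_carrier\<close>)
  then show "T closure_of S \<noteq> {}" using S.one_closed by blast
  fix a assume a: "a \<in> T closure_of S"
  have "(\<lambda>x. inv x) ` S \<subseteq> S" by auto
  then show "inv a \<in> T closure_of S"
    using continuous_map_image_closure_subset[OF continuous_inv, of S] closure_of_mono[of _ S T] a
    by blast
  fix b assume b: "b \<in> T closure_of S"
  have "(\<lambda>(x, y). x \<otimes> y) ` (S \<times> S) \<subseteq> S" by auto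
  moreover have "(a, b) \<in> prod_topology T T closure_of (S \<times> S)"
    using a b by (simp add: closure_of_Times)
  ultimately show "a \<otimes> b \<in> T closure_of S"
    using continuous_map_image_closure_subset[OF continuous_mult, of "S \<times> S"]
      closure_of_mono[of _ S T]
    by (metis (no_types, lifting) case_prod_conv image_subset_iff subsetD)
qed

lemma normal_closure_of:
  assumes "S \<lhd> G"
  shows "(T closure_of S) \<lhd> G"
proof -
  interpret S: normal S G by fact
  have "x \<otimes> n \<otimes> inv x \<in> T closure_of S" if "x \<in> carrier G" "n \<in> T closure_of S" for x n
  proof -
    have "continuous_map T T (\<lambda>n. x \<otimes> n \<otimes> inv x)"
      using that by (intro continuous_map_mult) (auto simp: topspace_eq_carrier)
    moreover have "(\<lambda>n. x \<otimes> n \<otimes> inv x) ` S \<subseteq> S"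
      using that S.inv_op_closed2 by auto
    ultimately show ?thesis
      using continuous_map_image_closure_subset[of T T _ S] closure_of_mono[of _ S T] that(2)
      by blast
  qed
  then show ?thesis
    using subgroup_closure_of S.subgroup_axioms by (simp add: normal_inv_iff)
qed

text \<open>The complement of the diagonal is the preimage of the complement of the identity under
  \<open>(x, y) \<mapsto> inv x \<otimes> y\<close>, hence open; an open box inside it has disjoint
  sides.\<close>

lemma Hausdorff_space_if_closedin_one:
  assumes "closedin T {\<one>}"
  shows "Hausdorff_space T"
  unfolding Hausdorff_space_def
proof (intro allI impI)
  fix x y assume xy: "x \<in> topspace T \<and> y \<in> topspace T \<and> x \<noteq> y"
  let ?D = "{p \<in> topspace (prod_topology T T). inv (fst p) \<otimes> snd p \<in> topspace T - {\<one>}}"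
  have "openin (prod_topology T T) ?D"
    by (rule openin_continuous_map_preimage[OF continuous_map_mult[OF continuous_map_inv]])
       (use assms in \<open>auto simp: closedin_def continuous_map_fst continuous_map_snd\<close>)
  moreover have "(x, y) \<in> ?D"
  proof -
    have "inv x \<otimes> y \<noteq> \<one>"
      using xy by (metis inv_closed inv_equality inv_inv topspace_eq_carrier)
    then show ?thesis using xy by (auto simp: topspace_eq_carrier)
  qed
  ultimately obtain U V where UV: "openin T U" "openin T V" "x \<in> U" "y \<in> V" "U \<times> V \<subseteq> ?D"
    unfolding openin_prod_topology_alt by meson
  have "disjnt U V"
    unfolding disjnt_iff
  proof (intro allI notI)
    fix z assume "z \<in> U \<and> z \<in> V"
    then have "(z, z) \<in> ?D" using UV(5) by blast
    then show False by (auto simp: topspace_eq_carrier)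
  qed
  with UV show "\<exists>U V. openin T U \<and> openin T V \<and> x \<in> U \<and> y \<in> V \<and> disjnt U V" by blast
qed

end

section \<open>Subgroups and products, the ingredients of fibre products\<close>

text \<open>The subspace topology is the pullback along the inclusion, so
  \<open>topological_group_pullback\<close> applies.\<close>

lemma topological_group_subgroup:
  assumes G: "topological_group G T" and S: "subgroup S G"
  shows "topological_group (G\<lparr>carrier := S\<rparr>) (subtopology T S)"
proof -
  interpret topological_group G T by fact
  have j: "(\<lambda>x. x) \<in> hom (G\<lparr>carrier := S\<rparr>) G"
    using subgroup.subset[OF S] by (auto simp: hom_def)
  have "pullback_topology S (\<lambda>x. x) T = subtopology T S"
    by (auto simp: topology_eq openin_pullback_topology openin_subtopology)
  with topological_group_pullback(1)[OF G subgroup_imp_group[OF S] j] show ?thesis by simp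
qed

lemma topological_group_product:
  assumes "\<And>i. i \<in> I \<Longrightarrow> topological_group (G i) (T i)"
  shows "topological_group (product_group I G) (product_topology T I)"
proof -
  have grp: "group (G i)" if "i \<in> I" for i
    using assms[OF that] by (simp add: topological_group_def)
  interpret group "product_group I G" by (simp add: grp)
  let ?T = "product_topology T I"
  have top: "topspace ?T = (\<Pi>\<^sub>E i\<in>I. carrier (G i))"
    using topological_group.topspace_eq_carrier[OF assms] by (simp cong: PiE_cong)
  have proj: "continuous_map ?T (T i) (\<lambda>x. x i)" if "i \<in> I" for i
    using that by (rule continuous_map_product_projection)
  show ?thesis
  proof unfold_locales
    show "topspace ?T = carrier (product_group I G)" by (simp only: top carrier_product_group)
    have "continuous_map (prod_topology ?T ?T) (T i) (\<lambda>p. fst p i \<otimes>\<^bsub>G i\<^esub> snd p i)" if "i \<in> I" for i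
    proof (rule topological_group.continuous_map_mult[OF assms[OF that]])
      show "continuous_map (prod_topology ?T ?T) (T i) (\<lambda>p. fst p i)"
        using continuous_map_compose[OF continuous_map_fst proj[OF that]] by (simp add: comp_def)
      show "continuous_map (prod_topology ?T ?T) (T i) (\<lambda>p. snd p i)"
        using continuous_map_compose[OF continuous_map_snd proj[OF that]] by (simp add: comp_def)
    qed
    then show "continuous_map (prod_topology ?T ?T) ?T (\<lambda>(x, y). x \<otimes>\<^bsub>product_group I G\<^esub> y)"
      by (auto simp: continuous_map_componentwise case_prod_beta)
    have "continuous_map ?T (T i) (\<lambda>x. inv\<^bsub>G i\<^esub> (x i))" if "i \<in> I" for i
      by (rule topological_group.continuous_map_inv[OF assms[OF that] proj[OF that]])
    then have "continuous_map ?T ?T (\<lambda>x. \<lambda>i\<in>I. inv\<^bsub>G i\<^esub> (x i))"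
      by (auto simp: continuous_map_componentwise)
    then show "continuous_map ?T ?T (\<lambda>x. inv\<^bsub>product_group I G\<^esub> x)"
      by (rule continuous_map_eq) (subst inv_product_group, auto simp: PiE_iff grp simp flip: topological_group.topspace_eq_carrier[OF assms])
  qed
qed


section \<open>Quotient groups\<close>

text \<open>The final topology of the coset map. Bounding \<open>U\<close> by the set of cosets
  fixes the underlying space, since the type also contains sets that are not cosets.\<close>

definition quotient_group_topology ::
  "('a, 'm) monoid_scheme \<Rightarrow> 'a topology \<Rightarrow> 'a set \<Rightarrow> 'a set topology"
  where "quotient_group_topology G T N =
    topology (\<lambda>U. U \<subseteq> carrier (G Mod N) \<and> openin T {x \<in> carrier G. N #>\<^bsub>G\<^esub> x \<in> U})"

context topological_group
begin

lemma openin_quotient_group_topology: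
  "openin (quotient_group_topology G T N) U \<longleftrightarrow>
    U \<subseteq> carrier (G Mod N) \<and> openin T {x \<in> carrier G. N #> x \<in> U}"
proof -
  let ?P = "\<lambda>U. U \<subseteq> carrier (G Mod N) \<and> openin T {x \<in> carrier G. N #> x \<in> U}"
  have "istopology ?P"
    unfolding istopology_def
  proof (intro conjI allI impI)
    fix A B assume AB: "?P A" "?P B"
    have "{x \<in> carrier G. N #> x \<in> A \<inter> B} =
        {x \<in> carrier G. N #> x \<in> A} \<inter> {x \<in> carrier G. N #> x \<in> B}" by auto
    with AB show "openin T {x \<in> carrier G. N #> x \<in> A \<inter> B}" by (simp add: openin_Int)
  next
    fix \<K> assume K: "\<forall>A\<in>\<K>. ?P A"
    have "{x \<in> carrier G. N #> x \<in> \<Union>\<K>} = (\<Union>A\<in>\<K>. {x \<in> carrier G. N #> x \<in> A})" by auto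
    with K show "openin T {x \<in> carrier G. N #> x \<in> \<Union>\<K>}" by (auto intro!: openin_Union)
  qed blast+
  then show ?thesis
    by (simp add: quotient_group_topology_def topology_inverse')
qed

lemma topspace_quotient_group_topology:
  "topspace (quotient_group_topology G T N) = carrier (G Mod N)"
proof -
  have "{x \<in> carrier G. N #> x \<in> carrier (G Mod N)} = topspace T"
    by (auto simp: carrier_FactGroup topspace_eq_carrier)
  then have "openin (quotient_group_topology G T N) (carrier (G Mod N))"
    by (simp add: openin_quotient_group_topology)
  then show ?thesis
    by (meson openin_quotient_group_topology openin_subset openin_topspace subset_antisym)
qed

lemma quotient_map_r_coset:
  "quotient_map T (quotient_group_topology G T N) (\<lambda>x. N #> x)"
  unfolding quotient_map_def topspace_quotient_group_topology
  by (auto simp: openin_quotient_group_topology topspace_eq_carrier carrier_FactGroup)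

text \<open>The saturation of an open set is a union of translates by elements of \<open>N\<close>,
  each open as the preimage of \<open>U\<close> under a left multiplication.\<close>

lemma open_map_r_coset:
  assumes "N \<lhd> G"
  shows "open_map T (quotient_group_topology G T N) (\<lambda>x. N #> x)"
  unfolding open_map_def
proof (intro allI impI)
  interpret N: normal N G by fact
  fix U assume U: "openin T U"
  then have UG: "U \<subseteq> carrier G" using openin_subset topspace_eq_carrier by blast
  have "{x \<in> carrier G. N #> x \<in> (\<lambda>x. N #> x) ` U}
      = (\<Union>n\<in>N. {x \<in> topspace T. n \<otimes> x \<in> U})" (is "?L = ?R")
  proof (intro equalityI subsetI)
    fix x assume "x \<in> ?L"
    then obtain u where u: "x \<in> carrier G" "u \<in> U" "N #> x = N #> u" by blast
    then have "u \<in> N #> x" using UG rcos_self[OF _ N.subgroup_axioms] by blast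
    then obtain n where "n \<in> N" "u = n \<otimes> x" by (auto simp: r_coset_def)
    then show "x \<in> ?R" using u by (auto simp: topspace_eq_carrier)
  next
    fix x assume "x \<in> ?R"
    then obtain n where n: "n \<in> N" "x \<in> carrier G" "n \<otimes> x \<in> U"
      by (auto simp: topspace_eq_carrier)
    then have "N #> (n \<otimes> x) = N #> x"
      using coset_mult_assoc[of N n x] N.subset N.rcos_const[OF is_group n(1)] by auto
    then show "x \<in> ?L" using n by (metis (mono_tags, lifting) image_eqI mem_Collect_eq)
  qed
  moreover have "openin T ?R"
    using N.subset
    by (intro openin_Union ballI)
       (auto intro!: openin_continuous_map_preimage[OF _ U] continuous_map_lmult)
  ultimately show "openin (quotient_group_topology G T N) ((\<lambda>x. N #> x) ` U)"
    using UG by (auto simp: openin_quotient_group_topology carrier_FactGroup)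
qed

text \<open>A product of quotient maps need not be a quotient map. Here it is one because the coset
  map is open, and multiplication descends along it.\<close>

lemma topological_group_quotient:
  assumes "N \<lhd> G"
  shows "topological_group (G Mod N) (quotient_group_topology G T N)"
proof -
  interpret N: normal N G by fact
  interpret Q: group "G Mod N" by (rule N.factorgroup_is_group)
  let ?Q = "quotient_group_topology G T N" and ?q = "\<lambda>x. N #> x"
  note q = quotient_imp_continuous_map[OF quotient_map_r_coset[of N]]
  have hom: "?q \<in> hom G (G Mod N)" by (rule N.r_coset_hom_Mod)
  interpret gh: group_hom G "G Mod N" ?q
    by (simp add: group_hom_def group_hom_axioms_def hom Q.group_axioms)
  have "open_map (prod_topology T T) (prod_topology ?Q ?Q) (\<lambda>(x, y). (?q x, ?q y))"
    unfolding open_map_def openin_prod_topology_alt[of ?Q]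
  proof (intro allI impI)
    fix W A B assume W: "openin (prod_topology T T) W" "(A, B) \<in> (\<lambda>(x, y). (?q x, ?q y)) ` W"
    then obtain x y where xy: "(x, y) \<in> W" "A = ?q x" "B = ?q y" by auto
    with W(1) obtain U V where UV: "openin T U" "openin T V" "x \<in> U" "y \<in> V" "U \<times> V \<subseteq> W"
      unfolding openin_prod_topology_alt by meson
    have "openin ?Q (?q ` U)" "openin ?Q (?q ` V)"
      using open_map_r_coset[OF assms] UV by (auto simp: open_map_def)
    moreover have "?q ` U \<times> ?q ` V \<subseteq> (\<lambda>(x, y). (?q x, ?q y)) ` W"
      using UV(5) by force
    ultimately show "\<exists>U V. openin ?Q U \<and> openin ?Q V \<and> A \<in> U \<and> B \<in> V
        \<and> U \<times> V \<subseteq> (\<lambda>(x, y). (?q x, ?q y)) ` W"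
      using UV xy by blast
  qed
  moreover have "continuous_map (prod_topology T T) (prod_topology ?Q ?Q) (\<lambda>(x, y). (?q x, ?q y))"
    by (simp add: continuous_map_prod_top q)
  moreover have "(\<lambda>(x, y). (?q x, ?q y)) ` topspace (prod_topology T T) = topspace (prod_topology ?Q ?Q)"
    by (force simp: topspace_eq_carrier topspace_quotient_group_topology carrier_FactGroup)
  ultimately have qq: "quotient_map (prod_topology T T) (prod_topology ?Q ?Q) (\<lambda>(x, y). (?q x, ?q y))"
    by (intro continuous_open_imp_quotient_map)
  have "continuous_map (prod_topology T T) ?Q (?q \<circ> (\<lambda>(x, y). x \<otimes> y))"
    by (rule continuous_map_compose[OF continuous_mult q])
  then have "continuous_map (prod_topology T T) ?Q
      ((\<lambda>(A, B). A \<otimes>\<^bsub>G Mod N\<^esub> B) \<circ> (\<lambda>(x, y). (?q x, ?q y)))"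
    by (rule continuous_map_eq) (auto simp: topspace_eq_carrier simp del: mult_FactGroup)
  then have m: "continuous_map (prod_topology ?Q ?Q) ?Q (\<lambda>(A, B). A \<otimes>\<^bsub>G Mod N\<^esub> B)"
    by (rule continuous_compose_quotient_map[OF qq])
  have "continuous_map T ?Q (?q \<circ> (\<lambda>x. inv x))"
    by (rule continuous_map_compose[OF continuous_inv q])
  then have "continuous_map T ?Q ((\<lambda>A. inv\<^bsub>G Mod N\<^esub> A) \<circ> ?q)"
    by (rule continuous_map_eq) (auto simp: topspace_eq_carrier)
  then have "continuous_map ?Q ?Q (\<lambda>A. inv\<^bsub>G Mod N\<^esub> A)"
    by (rule continuous_compose_quotient_map[OF quotient_map_r_coset])
  with m show ?thesis
    by unfold_locales (auto simp: topspace_quotient_group_topology)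
qed

text \<open>The coset \<open>N\<close> is the identity of the quotient and its preimage is
  \<open>N\<close> itself, so \<open>Hausdorff_space_if_closedin_one\<close> applies.\<close>

lemma Hausdorff_space_quotient:
  assumes "N \<lhd> G" and "closedin T N"
  shows "Hausdorff_space (quotient_group_topology G T N)"
proof -
  interpret N: normal N G by fact
  interpret Q: topological_group "G Mod N" "quotient_group_topology G T N"
    by (rule topological_group_quotient[OF assms(1)])
  have "{x \<in> topspace T. N #> x \<in> {N}} = N"
    using N.subset N.rcos_const N.subgroup_axioms coset_join1
    by (auto simp: topspace_eq_carrier)
  moreover have "{N} \<subseteq> topspace (quotient_group_topology G T N)"
    using Q.one_closed by (simp add: topspace_quotient_group_topology)
  ultimately have "closedin (quotient_group_topology G T N) {N}"
    using quotient_map_r_coset[of N] assms(2) by (auto simp: quotient_map_closedin)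
  then show ?thesis
    using Q.Hausdorff_space_if_closedin_one by simp
qed

end


section \<open>Og-filters\<close>

text \<open>By \<open>og_filterE\<close> and \<open>og_filter_trace_filter\<close>, og-filters are
  the proper filters of this form. The filter is confined to \<open>carrier G\<close> because
  \<open>filtercomap\<close> also sees the values of \<open>\<phi>\<close> outside the
  group.\<close>

definition trace_filter ::
  "('g, 'm) monoid_scheme \<Rightarrow> ('g \<Rightarrow> 'p) \<Rightarrow> 'p topology \<Rightarrow> 'p \<Rightarrow> 'g filter"
  where "trace_filter G \<phi> T x = inf (filtercomap \<phi> (nhdsin T x)) (principal (carrier G))"

lemma eventually_trace_filter:
  assumes "x \<in> topspace T"
  shows "eventually Q (trace_filter G \<phi> T x) \<longleftrightarrow>
    (\<exists>U. openin T U \<and> x \<in> U \<and> (\<forall>g\<in>carrier G. \<phi> g \<in> U \<longrightarrow> Q g))"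
proof -
  have "eventually Q (trace_filter G \<phi> T x) \<longleftrightarrow>
      (\<exists>R. (\<exists>U. openin T U \<and> x \<in> U \<and> (\<forall>y\<in>U. R y)) \<and> (\<forall>g. R (\<phi> g) \<longrightarrow> g \<in> carrier G \<longrightarrow> Q g))"
    using assms
    by (simp add: trace_filter_def eventually_inf_principal eventually_filtercomap eventually_nhdsin)
  also have "\<dots> \<longleftrightarrow> (\<exists>U. openin T U \<and> x \<in> U \<and> (\<forall>g\<in>carrier G. \<phi> g \<in> U \<longrightarrow> Q g))"
    (is "_ \<longleftrightarrow> ?rhs")
  proof
    assume ?rhs
    then obtain U where "openin T U" "x \<in> U" "\<forall>g\<in>carrier G. \<phi> g \<in> U \<longrightarrow> Q g" by blast
    then show "\<exists>R. (\<exists>U. openin T U \<and> x \<in> U \<and> (\<forall>y\<in>U. R y))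
        \<and> (\<forall>g. R (\<phi> g) \<longrightarrow> g \<in> carrier G \<longrightarrow> Q g)"
      by (intro exI[of _ "\<lambda>y. y \<in> U"]) blast
  qed blast
  finally show ?thesis .
qed

text \<open>Properness means that every neighbourhood of \<open>x\<close> meets the image. This
  turns questions about closed images into questions about filters.\<close>

lemma trace_filter_nontrivial_iff:
  assumes "x \<in> topspace T"
  shows "trace_filter G \<phi> T x \<noteq> bot \<longleftrightarrow> x \<in> T closure_of (\<phi> ` carrier G)"
  using assms
  by (auto simp: trivial_limit_def eventually_trace_filter in_closure_of)

lemma og_filterE:
  fixes G :: "('g, 'm) monoid_scheme" and H :: "('h, 'n) monoid_scheme"
  assumes "og_filter G TG H TH f F"
  obtains P :: "'g word monoid" and TP r \<phi> x where
    "topological_group P TP" "continuous_hom P TP H TH r" "continuous_hom G TG P TP \<phi>"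
    "\<forall>g\<in>carrier G. f g = r (\<phi> g)" "x \<in> carrier P" "F = trace_filter G \<phi> TP x"
proof -
  from assms obtain P :: "'g word monoid" and TP r \<phi> x where
    P: "topological_group P TP" "continuous_hom P TP H TH r" "continuous_hom G TG P TP \<phi>"
    "\<forall>g\<in>carrier G. f g = r (\<phi> g)" "x \<in> carrier P"
    and F: "\<And>A. (\<forall>\<^sub>F g in F. g \<in> A) \<longleftrightarrow>
        (\<exists>U. openin TP U \<and> x \<in> U \<and> {g \<in> carrier G. \<phi> g \<in> U} \<subseteq> A)"
    unfolding og_filter_def by blast
  have "eventually Q F \<longleftrightarrow> eventually Q (trace_filter G \<phi> TP x)" for Q
    using F[of "Collect Q"] P(5)
    by (simp add: eventually_trace_filter topological_group.topspace_eq_carrier[OF P(1)] subset_iff)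
       blast
  then have "F = trace_filter G \<phi> TP x" by (simp add: filter_eq_iff)
  with P show ?thesis by (rule that)
qed

text \<open>Thanks to \<open>og_filterI\<close> the group \<open>P\<close> may live on any type, as
  the fibre product in \<open>og_filter_Inf\<close> requires.\<close>

lemma og_filter_trace_filter:
  assumes "topological_group G TG" and P: "topological_group P TP"
    and "continuous_hom P TP H TH r" and "continuous_hom G TG P TP \<phi>"
    and "\<And>g. g \<in> carrier G \<Longrightarrow> f g = r (\<phi> g)" and x: "x \<in> carrier P"
    and "trace_filter G \<phi> TP x \<noteq> bot"
  shows "og_filter G TG H TH f (trace_filter G \<phi> TP x)"
proof (rule og_filterI[OF assms])
  have "x \<in> topspace TP" using x by (simp add: topological_group.topspace_eq_carrier[OF P])
  then show "(\<forall>\<^sub>F g in trace_filter G \<phi> TP x. g \<in> A) \<longleftrightarrow>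
      (\<exists>U. openin TP U \<and> x \<in> U \<and> {g \<in> carrier G. \<phi> g \<in> U} \<subseteq> A)" for A
    by (auto simp: eventually_trace_filter subset_iff)
qed

text \<open>Witnessed by \<open>G\<close> itself, with the identity as \<open>\<phi>\<close> and
  \<open>f\<close> as \<open>r\<close>.\<close>

lemma og_filter_nhdsin:
  assumes G: "topological_group G TG" and f: "continuous_hom G TG H TH f" and c: "c \<in> carrier G"
  shows "og_filter G TG H TH f (nhdsin TG c)"
proof -
  note top = topological_group.topspace_eq_carrier[OF G]
  have "nhdsin TG c \<le> principal (carrier G)"
    using c by (auto simp: le_principal eventually_nhdsin simp flip: top)
  then have eq: "trace_filter G (\<lambda>x. x) TG c = nhdsin TG c"
    by (simp add: trace_filter_def inf_absorb1 filtercomap_ident)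
  have "\<not> eventually (\<lambda>_. False) (nhdsin TG c)"
    using c by (auto simp: eventually_nhdsin top)
  then have "nhdsin TG c \<noteq> bot" by (auto simp: trivial_limit_def)
  then show ?thesis
    using og_filter_trace_filter[OF G G f _ _ c, of "\<lambda>x. x" f]
    by (simp add: eq continuous_hom_def hom_def)
qed

text \<open>Over a Hausdorff target, a proper trace thus determines the fibre in which its
  witnessing point lies.\<close>

lemma limitin_trace_filter:
  assumes "continuous_map T T' r" and "\<And>g. g \<in> carrier G \<Longrightarrow> f g = r (\<phi> g)"
    and "\<And>g. g \<in> carrier G \<Longrightarrow> \<phi> g \<in> topspace T" and x: "x \<in> topspace T"
  shows "limitin T' f (r x) (trace_filter G \<phi> T x)"
  unfolding limitin_def
proof (intro conjI allI impI)
  show "r x \<in> topspace T'"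
    using assms by (meson continuous_map_image_subset_topspace image_subset_iff)
  fix V assume V: "openin T' V \<and> r x \<in> V"
  then have "openin T {y \<in> topspace T. r y \<in> V}"
    using assms(1) by (blast intro: openin_continuous_map_preimage)
  with V assms show "\<forall>\<^sub>F g in trace_filter G \<phi> T x. f g \<in> V"
    unfolding eventually_trace_filter[OF x]
    by (intro exI[of _ "{y \<in> topspace T. r y \<in> V}"]) auto
qed

lemma limitin_filter_mono: "limitin T f l F \<Longrightarrow> F' \<le> F \<Longrightarrow> limitin T f l F'"
  by (auto simp: limitin_def le_filter_def)

section \<open>Infima of og-filters and maximal og-filters\<close>

text \<open>The infimum is the trace of a point of the fibre product over \<open>H\<close> of the groups that induce
  the given filters: since \<open>H\<close> is Hausdorff and the infimum is proper, the points inducing them all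
  lie over the limit of \<open>f\<close>.\<close>

lemma og_filter_Inf:
  fixes G :: "('g, 'm) monoid_scheme" and H :: "('h, 'n) monoid_scheme"
  assumes G: "topological_group G TG" and H: "topological_group H TH" and T2: "Hausdorff_space TH"
    and C: "C \<noteq> {}" "\<And>F. F \<in> C \<Longrightarrow> og_filter G TG H TH f F" and proper: "Inf C \<noteq> bot"
  shows "og_filter G TG H TH f (Inf C)"
proof -
  \<comment> \<open>Bundling the data into one predicate lets a single choice select group, maps and
    point for every \<open>F\<close> in \<open>C\<close>.\<close>
  define W where "W F P TP r \<phi> x \<longleftrightarrow>
      topological_group P TP \<and> continuous_hom P TP H TH r \<and> continuous_hom G TG P TP \<phi> \<and>
      (\<forall>g\<in>carrier G. f g = r (\<phi> g)) \<and> x \<in> carrier P \<and> trace_filter G \<phi> TP x = F"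
    for F and P :: "'g word monoid" and TP r \<phi> x
  have "\<exists>P TP r \<phi> x. W F P TP r \<phi> x" if "F \<in> C" for F
  proof -
    from C(2)[OF that] obtain P :: "'g word monoid" and TP r \<phi> x where
      "topological_group P TP" "continuous_hom P TP H TH r" "continuous_hom G TG P TP \<phi>"
      "\<forall>g\<in>carrier G. f g = r (\<phi> g)" "x \<in> carrier P" "F = trace_filter G \<phi> TP x"
      by (rule og_filterE)
    then have "W F P TP r \<phi> x" by (simp add: W_def)
    then show ?thesis by blast
  qed
  then obtain P TP r \<phi> x where W: "\<And>F. F \<in> C \<Longrightarrow> W F (P F) (TP F) (r F) (\<phi> F) (x F)"
    by metis
  note W' = W[unfolded W_def]
  have P: "\<And>F. F \<in> C \<Longrightarrow> topological_group (P F) (TP F)"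
    and r: "\<And>F. F \<in> C \<Longrightarrow> continuous_hom (P F) (TP F) H TH (r F)"
    and \<phi>: "\<And>F. F \<in> C \<Longrightarrow> continuous_hom G TG (P F) (TP F) (\<phi> F)"
    and fr: "\<And>F g. F \<in> C \<Longrightarrow> g \<in> carrier G \<Longrightarrow> f g = r F (\<phi> F g)"
    and x: "\<And>F. F \<in> C \<Longrightarrow> x F \<in> carrier (P F)"
    and F: "\<And>F. F \<in> C \<Longrightarrow> trace_filter G (\<phi> F) (TP F) (x F) = F"
    using W' by blast+
  obtain F0 where F0: "F0 \<in> C" using C(1) by blast
  interpret G: topological_group G TG by fact
  interpret H: topological_group H TH by fact
  note top = topological_group.topspace_eq_carrier[OF P]
  have grp: "group (P F)" if "F \<in> C" for F
    using P[OF that] by (simp add: topological_group_def)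
  have \<phi>P: "\<phi> F g \<in> carrier (P F)" if "F \<in> C" "g \<in> carrier G" for F g
    using \<phi>[OF that(1)] that(2) by (auto simp: continuous_hom_def hom_def)
  have lim: "limitin TH f (r F (x F)) (Inf C)" if "F \<in> C" for F
  proof (rule limitin_filter_mono[OF _ Inf_lower[OF that]])
    have "limitin TH f (r F (x F)) (trace_filter G (\<phi> F) (TP F) (x F))"
      using r[OF that] fr[OF that] \<phi>P[OF that] x[OF that]
      by (intro limitin_trace_filter) (auto simp: continuous_hom_def top[OF that])
    then show "limitin TH f (r F (x F)) F" by (simp add: F that)
  qed
  have rx: "r F (x F) = r F0 (x F0)" if "F \<in> C" for F
    using limitin_Hausdorff_unique[OF lim[OF that] lim[OF F0] proper T2] .
  let ?Q = "product_group C P" and ?T = "product_topology TP C"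
  \<comment> \<open>The fibre product over \<open>H\<close>; \<open>F0\<close> serves as the
    reference coordinate with which all others are compared.\<close>
  define S where "S = {p \<in> carrier ?Q. \<forall>F\<in>C. r F (p F) = r F0 (p F0)}"
  have rgh: "group_hom (P F) H (r F)" if "F \<in> C" for F
    using r[OF that] grp[OF that] H.group_axioms
    by (simp add: group_hom_def group_hom_axioms_def continuous_hom_def)
  interpret Q: topological_group ?Q ?T by (rule topological_group_product[OF P])
  have SI: "p \<in> S" if "p \<in> carrier ?Q" "\<And>F. F \<in> C \<Longrightarrow> r F (p F) = r F0 (p F0)" for p
    unfolding S_def using that by blast
  have SD: "p \<in> carrier ?Q" "F \<in> C \<Longrightarrow> p F \<in> carrier (P F)" "F \<in> C \<Longrightarrow> r F (p F) = r F0 (p F0)"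
    if "p \<in> S" for p F
    using that by (auto simp: S_def)
  have S: "subgroup S ?Q"
  proof (rule Q.subgroupI)
    show "S \<subseteq> carrier ?Q" using SD(1) by blast
    have "\<one>\<^bsub>?Q\<^esub> \<in> S"
      by (rule SI[OF Q.one_closed]) (simp add: F0 group_hom.hom_one[OF rgh])
    then show "S \<noteq> {}" by blast
    fix p assume p: "p \<in> S"
    have "r F ((inv\<^bsub>?Q\<^esub> p) F) = inv\<^bsub>H\<^esub> (r F0 (p F0))" if "F \<in> C" for F
    proof -
      have "(inv\<^bsub>?Q\<^esub> p) F = inv\<^bsub>P F\<^esub> (p F)"
        using SD(1)[OF p] that grp by (subst inv_product_group) auto
      then show ?thesis
        using group_hom.hom_inv[OF rgh[OF that] SD(2)[OF p that]] SD(3)[OF p that] by metis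
    qed
    then show "inv\<^bsub>?Q\<^esub> p \<in> S"
      using F0 by (intro SI Q.inv_closed SD(1)[OF p]) metis
    fix q assume q: "q \<in> S"
    have "r F ((p \<otimes>\<^bsub>?Q\<^esub> q) F) = r F0 (p F0) \<otimes>\<^bsub>H\<^esub> r F0 (q F0)" if "F \<in> C" for F
    proof -
      have "(p \<otimes>\<^bsub>?Q\<^esub> q) F = p F \<otimes>\<^bsub>P F\<^esub> q F" using that by simp
      then show ?thesis
        using group_hom.hom_mult[OF rgh[OF that] SD(2)[OF p that] SD(2)[OF q that]]
          SD(3)[OF p that] SD(3)[OF q that] by metis
    qed
    then show "p \<otimes>\<^bsub>?Q\<^esub> q \<in> S"
      using F0 by (intro SI Q.m_closed SD(1)[OF p] SD(1)[OF q]) metis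
  qed
  let ?S = "?Q\<lparr>carrier := S\<rparr>" and ?TS = "subtopology ?T S"
  have STS: "topological_group ?S ?TS" by (rule topological_group_subgroup[OF Q.topological_group_axioms S])
  have topS: "topspace ?TS = S" using topological_group.topspace_eq_carrier[OF STS] by simp
  have proj: "continuous_map ?TS (TP F) (\<lambda>p. p F)" if "F \<in> C" for F
    by (intro continuous_map_from_subtopology continuous_map_product_projection that)
  define \<Phi> where "\<Phi> g = (\<lambda>F\<in>C. \<phi> F g)" for g
  define x0 where "x0 = (\<lambda>F\<in>C. x F)"
  have x0: "x0 \<in> S"
  proof (rule SI)
    show "x0 \<in> carrier ?Q" using x by (simp add: x0_def)
    show "r F (x0 F) = r F0 (x0 F0)" if "F \<in> C" for F
      unfolding x0_def restrict_apply'[OF that] restrict_apply'[OF F0] by (rule rx[OF that])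
  qed
  have \<Phi>S: "\<Phi> g \<in> S" if "g \<in> carrier G" for g
  proof (rule SI)
    show "\<Phi> g \<in> carrier ?Q" using \<phi>P that by (simp add: \<Phi>_def)
    show "r F (\<Phi> g F) = r F0 (\<Phi> g F0)" if "F \<in> C" for F
      unfolding \<Phi>_def restrict_apply'[OF that] restrict_apply'[OF F0]
      using fr[OF that \<open>g \<in> carrier G\<close>] fr[OF F0 \<open>g \<in> carrier G\<close>] by (rule trans[OF sym])
  qed
  have R: "continuous_hom ?S ?TS H TH (\<lambda>p. r F0 (p F0))"
    unfolding continuous_hom_def
  proof
    show "(\<lambda>p. r F0 (p F0)) \<in> hom ?S H"
      using r[OF F0] F0 SD(2)[OF _ F0] by (auto simp: hom_def continuous_hom_def)
    show "continuous_map ?TS TH (\<lambda>p. r F0 (p F0))"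
      using continuous_map_compose[OF proj[OF F0], of TH "r F0"] r[OF F0]
      by (simp add: continuous_hom_def comp_def)
  qed
  have \<Phi>hom: "continuous_hom G TG ?S ?TS \<Phi>"
    unfolding continuous_hom_def
  proof
    have "\<Phi> (g \<otimes>\<^bsub>G\<^esub> h) = \<Phi> g \<otimes>\<^bsub>?Q\<^esub> \<Phi> h" if "g \<in> carrier G" "h \<in> carrier G" for g h
      using \<phi> that by (auto simp: \<Phi>_def continuous_hom_def hom_def fun_eq_iff)
    then show "\<Phi> \<in> hom G ?S" using \<Phi>S by (auto simp: hom_def)
    have "continuous_map TG ?T \<Phi>"
      using \<phi> by (auto simp: continuous_map_componentwise \<Phi>_def continuous_hom_def)
    then show "continuous_map TG ?TS \<Phi>"
      using \<Phi>S by (auto simp: continuous_map_in_subtopology G.topspace_eq_carrier)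
  qed
  have "trace_filter G \<Phi> ?TS x0 = Inf C"
  proof (rule antisym)
    show "trace_filter G \<Phi> ?TS x0 \<le> Inf C"
    proof (rule Inf_greatest, rule filter_leI)
      fix F Q assume FC: "F \<in> C" and "eventually Q F"
      then have "eventually Q (trace_filter G (\<phi> F) (TP F) (x F))" by (simp add: F)
      then obtain U where U: "openin (TP F) U" "x F \<in> U" "\<forall>g\<in>carrier G. \<phi> F g \<in> U \<longrightarrow> Q g"
        using x[OF FC] by (auto simp: eventually_trace_filter top[OF FC])
      have "openin ?TS {p \<in> topspace ?TS. p F \<in> U}"
        by (rule openin_continuous_map_preimage[OF proj[OF FC] U(1)])
      then show "eventually Q (trace_filter G \<Phi> ?TS x0)"
        using U x0 FC
        by (subst eventually_trace_filter)
           (auto simp: topS \<Phi>_def x0_def intro!: exI[of _ "{p \<in> S. p F \<in> U}"] simp del: topspace_subtopology)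
    qed
    show "Inf C \<le> trace_filter G \<Phi> ?TS x0"
    proof (rule filter_leI)
      fix Q assume "eventually Q (trace_filter G \<Phi> ?TS x0)"
      then obtain W where W: "openin ?TS W" "x0 \<in> W" "\<forall>g\<in>carrier G. \<Phi> g \<in> W \<longrightarrow> Q g"
        using x0 by (subst (asm) eventually_trace_filter) (auto simp: topS simp del: topspace_subtopology)
      then obtain W' where W': "openin ?T W'" "W = W' \<inter> S" by (auto simp: openin_subtopology)
      have "x0 \<in> W'" using W(2) W'(2) by blast
      from bspec[OF W'(1)[unfolded openin_product_topology_alt] this]
      \<comment> \<open>A basic open box constrains only the finitely many coordinates in
        \<open>?J\<close>, so finitely many eventual conditions suffice.\<close>
      obtain U where U: "finite {F \<in> C. U F \<noteq> topspace (TP F)}" (is "finite ?J")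
        "\<forall>F\<in>C. openin (TP F) (U F)" "x0 \<in> Pi\<^sub>E C U" "Pi\<^sub>E C U \<subseteq> W'"
        by (elim exE conjE)
      have ev: "\<forall>\<^sub>F g in Inf C. g \<in> carrier G \<and> \<phi> F g \<in> U F" if "F \<in> C" for F
      proof (rule filter_leD[OF Inf_lower[OF that]])
        have "x F \<in> U F" using U(3) that by (auto simp: x0_def PiE_iff)
        then have "\<forall>\<^sub>F g in trace_filter G (\<phi> F) (TP F) (x F). g \<in> carrier G \<and> \<phi> F g \<in> U F"
          using bspec[OF U(2) that] x[OF that] by (subst eventually_trace_filter) (auto simp: top[OF that])
        then show "\<forall>\<^sub>F g in F. g \<in> carrier G \<and> \<phi> F g \<in> U F" by (simp add: F that)
      qed
      have "\<forall>\<^sub>F g in Inf C. \<forall>F\<in>?J. g \<in> carrier G \<and> \<phi> F g \<in> U F"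
        by (rule eventually_ball_finite[OF U(1)]) (simp add: ev)
      \<comment> \<open>\<open>ev[OF F0]\<close> supplies \<open>g \<in> carrier G\<close>, which
        the statement over \<open>?J\<close> does not give when \<open>?J\<close> is empty.\<close>
      with ev[OF F0] show "eventually Q (Inf C)"
      proof (rule eventually_elim2)
        fix g assume g: "g \<in> carrier G \<and> \<phi> F0 g \<in> U F0"
          and J: "\<forall>F\<in>?J. g \<in> carrier G \<and> \<phi> F g \<in> U F"
        have "\<phi> F g \<in> U F" if "F \<in> C" for F
          using \<phi>P[OF that] top[OF that] that g J by (cases "U F = topspace (TP F)") auto
        then have "\<Phi> g \<in> W'" using U(4) by (auto simp: \<Phi>_def)
        then show "Q g" using W W' \<Phi>S g by blast
      qed
    qed
  qed
  moreover have "f g = r F0 (\<Phi> g F0)" if "g \<in> carrier G" for g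
    using fr[OF F0 that] F0 by (simp add: \<Phi>_def)
  ultimately show ?thesis
    using og_filter_trace_filter[OF G STS R \<Phi>hom, of f x0] x0 proper by simp
qed

text \<open>Zorn's lemma for \<open>\<ge>\<close>, since finer filters are smaller. A nonempty chain
  is bounded by its infimum, which \<open>og_filter_Inf\<close> makes an og-filter once it is
  proper.\<close>

lemma ex_maximal_og_filter_le:
  assumes "topological_group G TG" and "topological_group H TH" and "Hausdorff_space TH"
    and F: "og_filter G TG H TH f F"
  obtains M where "maximal_og_filter G TG H TH f M" "M \<le> F"
proof -
  let ?A = "{M. og_filter G TG H TH f M \<and> M \<le> F}"
  have "\<exists>M\<in>?A. \<forall>M'\<in>?A. M \<ge> M' \<longrightarrow> M' = M"
  proof (rule predicate_Zorn)
    show "partial_order_on ?A (relation_of (\<ge>) ?A)"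
      by (rule partial_order_on_relation_ofI) auto
    fix C assume C: "C \<in> Chains (relation_of (\<ge>) ?A)"
    then have CA: "C \<subseteq> ?A" and chain: "\<And>M M'. M \<in> C \<Longrightarrow> M' \<in> C \<Longrightarrow> M \<le> M' \<or> M' \<le> M"
      by (auto simp: Chains_def relation_of_def)
    show "\<exists>u\<in>?A. \<forall>M\<in>C. M \<ge> u"
    proof (cases "C = {}")
      case True
      then show ?thesis using F by auto
    next
      case False
      \<comment> \<open>A chain is a base of its infimum, so the infimum could be improper only if
        some member were.\<close>
      have "\<exists>K\<in>C. K \<le> inf M M'" if "M \<in> C" "M' \<in> C" for M M'
        using chain[OF that] that by (metis inf_absorb1 inf_absorb2 order_refl)
      then have "eventually (\<lambda>_. False) (Inf C) \<longleftrightarrow> (\<exists>M\<in>C. eventually (\<lambda>_. False) M)"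
        using False by (rule eventually_Inf_base[rotated])
      moreover have "M \<noteq> bot" if "M \<in> C" for M
        using CA that by (auto simp: og_filter_def)
      ultimately have "Inf C \<noteq> bot" by (auto simp: trivial_limit_def)
      then have "og_filter G TG H TH f (Inf C)"
        using og_filter_Inf[OF assms(1-3) False] CA by blast
      moreover have "Inf C \<le> F" using False CA by (auto intro: Inf_less_eq)
      ultimately show ?thesis by (auto intro: Inf_lower)
    qed
  qed
  then obtain M where "M \<in> ?A" "\<forall>M'\<in>?A. M \<ge> M' \<longrightarrow> M' = M" by blast
  then have "maximal_og_filter G TG H TH f M"
    by (auto simp: maximal_og_filter_def dest: order_trans)
  with \<open>M \<in> ?A\<close> show ?thesis using that by blast
qed

section \<open>Cluster points and convergence in the lattice of filters\<close>

text \<open>Puts clustering into the shape of the properness hypothesis of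
  \<open>og_filter_Inf\<close>.\<close>

lemma cluster_point_iff_inf_nhdsin:
  "cluster_point T F c \<longleftrightarrow> c \<in> topspace T \<and> inf F (nhdsin T c) \<noteq> bot"
proof (cases "c \<in> topspace T")
  case True
  have "inf F (nhdsin T c) = bot \<longleftrightarrow>
      (\<exists>Q R. eventually Q F \<and> (\<exists>U. openin T U \<and> c \<in> U \<and> (\<forall>x\<in>U. R x)) \<and> (\<forall>x. Q x \<longrightarrow> \<not> R x))"
    using True by (simp add: trivial_limit_def eventually_inf eventually_nhdsin)
  also have "\<dots> \<longleftrightarrow> (\<exists>U A. openin T U \<and> c \<in> U \<and> (\<forall>\<^sub>F x in F. x \<in> A) \<and> U \<inter> A = {})"
    (is "?lhs \<longleftrightarrow> ?rhs")
  proof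
    assume ?lhs
    then obtain Q R U where "eventually Q F" "openin T U" "c \<in> U" "\<forall>x\<in>U. R x" "\<forall>x. Q x \<longrightarrow> \<not> R x"
      by blast
    then show ?rhs by (intro exI[of _ U] exI[of _ "Collect Q"]) auto
  next
    assume ?rhs
    then obtain U A where "openin T U" "c \<in> U" "\<forall>\<^sub>F x in F. x \<in> A" "U \<inter> A = {}" by blast
    then show ?lhs
      by (intro exI[of _ "\<lambda>x. x \<in> A"] exI[of _ "\<lambda>x. x \<in> U"] conjI exI[of _ U]) auto
  qed
  finally show ?thesis using True by (auto simp: cluster_point_def)
qed (simp add: cluster_point_def)

lemma filter_converges_iff_le_nhdsin:
  "filter_converges T F c \<longleftrightarrow> c \<in> topspace T \<and> F \<le> nhdsin T c"
proof (intro iffI conjI; (elim conjE)?)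
  assume lim: "filter_converges T F c"
  then show "c \<in> topspace T" by (simp add: limitin_def)
  show "F \<le> nhdsin T c"
  proof (rule filter_leI)
    fix Q assume "eventually Q (nhdsin T c)"
    then obtain U where U: "openin T U" "c \<in> U" "\<forall>x\<in>U. Q x"
      using \<open>c \<in> topspace T\<close> by (auto simp: eventually_nhdsin)
    then have "\<forall>\<^sub>F x in F. x \<in> U" using lim by (simp add: limitin_def)
    then show "eventually Q F" by (rule eventually_mono) (use U in blast)
  qed
next
  assume c: "c \<in> topspace T" and le: "F \<le> nhdsin T c"
  have "\<forall>\<^sub>F x in nhdsin T c. x \<in> U" if "openin T U" "c \<in> U" for U
    using that by (auto simp: eventually_nhdsin)
  with c show "filter_converges T F c"
    unfolding limitin_def by (blast intro: filter_leD[OF le])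
qed

text \<open>A maximal og-filter equals its proper meet with a neighbourhood filter. Conversely, a
  convergent maximal refinement \<open>M\<close> of \<open>F\<close> lies below both
  \<open>F\<close> and a neighbourhood filter, so their meet is proper.\<close>

lemma og_filters_cluster_iff_maximal_converge:
  assumes G: "topological_group G TG" and H: "topological_group H TH" and T2: "Hausdorff_space TH"
    and f: "continuous_hom G TG H TH f"
  shows "(\<forall>F. og_filter G TG H TH f F \<longrightarrow> (\<exists>c. cluster_point TG F c)) \<longleftrightarrow>
    (\<forall>F. maximal_og_filter G TG H TH f F \<longrightarrow> (\<exists>c. filter_converges TG F c))"
proof (intro iffI allI impI)
  fix F
  assume cl: "\<forall>F. og_filter G TG H TH f F \<longrightarrow> (\<exists>c. cluster_point TG F c)"
    and max: "maximal_og_filter G TG H TH f F"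
  from max have og: "og_filter G TG H TH f F" by (simp add: maximal_og_filter_def)
  with cl have "\<exists>c. cluster_point TG F c" by blast
  then obtain c where c: "c \<in> topspace TG" "inf F (nhdsin TG c) \<noteq> bot"
    by (auto simp: cluster_point_iff_inf_nhdsin)
  then have "og_filter G TG H TH f (nhdsin TG c)"
    using og_filter_nhdsin[OF G f] by (simp add: topological_group.topspace_eq_carrier[OF G])
  then have "og_filter G TG H TH f (inf F (nhdsin TG c))"
    using og_filter_Inf[OF G H T2, of "{F, nhdsin TG c}"] og c by auto
  then have "inf F (nhdsin TG c) = F"
    using max by (auto simp: maximal_og_filter_def)
  then have "F \<le> nhdsin TG c" by (metis inf_le2)
  then show "\<exists>c. filter_converges TG F c"
    using c by (auto simp: filter_converges_iff_le_nhdsin)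
next
  fix F
  assume conv: "\<forall>F. maximal_og_filter G TG H TH f F \<longrightarrow> (\<exists>c. filter_converges TG F c)"
    and "og_filter G TG H TH f F"
  then obtain M where M: "maximal_og_filter G TG H TH f M" "M \<le> F"
    using ex_maximal_og_filter_le[OF G H T2] by blast
  then obtain c where c: "c \<in> topspace TG" "M \<le> nhdsin TG c"
    using conv by (auto simp: filter_converges_iff_le_nhdsin)
  have "M \<noteq> bot" using M by (simp add: maximal_og_filter_def og_filter_def)
  then have "inf F (nhdsin TG c) \<noteq> bot"
    using M c by (metis bot.extremum_uniqueI le_inf_iff)
  then show "\<exists>c. cluster_point TG F c"
    using c by (auto simp: cluster_point_iff_inf_nhdsin)
qed


section \<open>h-completeness\<close>

text \<open>Dividing out the closure \<open>N\<close> of the trivial subgroup makes h-completeness applicable to an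
  arbitrary group \<open>P\<close> over \<open>H\<close>, and points of \<open>P\<close> in the same coset of \<open>N\<close> have the same
  neighbourhoods.\<close>

lemma h_complete_closure_point:
  assumes f: "h_complete G TG H TH f" and G: "topological_group G TG"
    and H: "topological_group H TH" and T2: "Hausdorff_space TH"
    and P: "topological_group P TP" and r: "continuous_hom P TP H TH r"
    and \<phi>: "continuous_hom G TG P TP \<phi>" and fr: "\<And>g. g \<in> carrier G \<Longrightarrow> f g = r (\<phi> g)"
    and x: "x \<in> TP closure_of (\<phi> ` carrier G)"
  obtains g where "g \<in> carrier G" "\<And>U. openin TP U \<Longrightarrow> x \<in> U \<Longrightarrow> \<phi> g \<in> U"
proof -
  interpret P: topological_group P TP by fact
  interpret H: topological_group H TH by fact
  have rhom: "r \<in> hom P H" and rc: "continuous_map TP TH r"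
    using r by (auto simp: continuous_hom_def)
  interpret r: group_hom P H r
    by (simp add: group_hom_def group_hom_axioms_def rhom P.group_axioms H.group_axioms)
  have \<phi>P: "\<phi> g \<in> carrier P" if "g \<in> carrier G" for g
    using \<phi> that by (auto simp: continuous_hom_def hom_def)
  define N where "N = TP closure_of {\<one>\<^bsub>P\<^esub>}"
  have N: "N \<lhd> P" unfolding N_def by (rule P.normal_closure_of[OF P.one_is_normal])
  interpret N: normal N P by fact
  let ?K = "P Mod N" and ?TK = "quotient_group_topology P TP N" and ?q = "\<lambda>p. N #>\<^bsub>P\<^esub> p"
  have qhom: "continuous_hom P TP ?K ?TK ?q"
    unfolding continuous_hom_def
    using N.r_coset_hom_Mod quotient_imp_continuous_map[OF P.quotient_map_r_coset] by blast
  \<comment> \<open>Continuity sends the closure of the identity into the closure of the identity of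
    \<open>H\<close>, a single point.\<close>
  have rN: "r n = \<one>\<^bsub>H\<^esub>" if "n \<in> N" for n
  proof -
    have "closedin TH {\<one>\<^bsub>H\<^esub>}"
      using T2 by (simp add: Hausdorff_imp_t1_space closedin_t1_singleton H.topspace_eq_carrier)
    then show ?thesis
      using continuous_map_image_closure_subset[OF rc, of "{\<one>\<^bsub>P\<^esub>}"] that
      by (auto simp: N_def closure_of_closedin)
  qed
  have coset: "\<exists>n\<in>N. p = n \<otimes>\<^bsub>P\<^esub> p'" if "p \<in> carrier P" "?q p = ?q p'" for p p'
    using P.rcos_self[OF that(1) N.subgroup_axioms] that(2) by (auto simp: r_coset_def)
  have "r p = r p'" if "p \<in> carrier P" "p' \<in> carrier P" "?q p = ?q p'" for p p'
    using coset[OF that(1,3)] rN that(2) N.subset by auto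
  then obtain k where k: "k \<in> hom ?K H" "\<And>p. p \<in> carrier P \<Longrightarrow> k (?q p) = r p"
    using FactGroup_universal[OF rhom N] by metis
  have "continuous_map TP TH (k \<circ> ?q)"
    by (rule continuous_map_eq[OF rc]) (simp add: k P.topspace_eq_carrier)
  then have kc: "continuous_hom ?K ?TK H TH k"
    unfolding continuous_hom_def
    using k(1) continuous_compose_quotient_map[OF P.quotient_map_r_coset] by blast
  have "fibrewise_Hausdorff ?TK k"
    using P.Hausdorff_space_quotient[OF N]
    by (simp add: N_def fibrewise_Hausdorff_def Hausdorff_space_def)
  \<comment> \<open>\<open>?K\<close> lives on a type of cosets, so the type-independent form
    \<open>h_completeD\<close> is used.\<close>
  then have "closedin ?TK ((?q \<circ> \<phi>) ` carrier G)"
    using h_completeD[OF f G P.topological_group_quotient[OF N] continuous_hom_compose[OF \<phi> qhom] kc]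
    by (simp add: fr k \<phi>P)
  moreover have "?q x \<in> ?TK closure_of (?q ` \<phi> ` carrier G)"
    using continuous_map_image_closure_subset[of TP ?TK ?q] qhom x
    by (auto simp: continuous_hom_def)
  ultimately obtain g where g: "g \<in> carrier G" "?q x = ?q (\<phi> g)"
    by (auto simp: closure_of_closedin image_comp)
  have xP: "x \<in> carrier P" using x by (auto simp: in_closure_of P.topspace_eq_carrier)
  obtain n where n: "n \<in> N" "x = n \<otimes>\<^bsub>P\<^esub> \<phi> g" using coset[OF xP g(2)] by blast
  \<comment> \<open>Translating \<open>U\<close> back by \<open>\<phi> g\<close> gives a
    neighbourhood of \<open>n\<close>; as \<open>n\<close> is in the closure of the identity, it
    contains the identity.\<close>
  have "\<phi> g \<in> U" if U: "openin TP U" "x \<in> U" for U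
  proof -
    have "openin TP {y \<in> topspace TP. y \<otimes>\<^bsub>P\<^esub> \<phi> g \<in> U}" (is "openin TP ?V")
      by (rule openin_continuous_map_preimage[OF P.continuous_map_rmult U(1)]) (simp add: \<phi>P g)
    moreover have "n \<in> ?V" using n U N.subset by (auto simp: P.topspace_eq_carrier)
    moreover have "n \<in> TP closure_of {\<one>\<^bsub>P\<^esub>}" using n(1) by (simp add: N_def)
    ultimately have "\<exists>z\<in>{\<one>\<^bsub>P\<^esub>}. z \<in> ?V"
      unfolding in_closure_of by meson
    then have "\<one>\<^bsub>P\<^esub> \<in> ?V" by simp
    then show ?thesis by (simp add: \<phi>P g)
  qed
  with g(1) show ?thesis by (rule that)
qed

text \<open>Forward, \<open>h_complete_closure_point\<close> gives a point common to all members of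
  the filter. Backward, the cluster point of the trace of \<open>y\<close> is a preimage of
  \<open>y\<close> under \<open>h\<close>.\<close>

lemma h_complete_iff_og_filters_cluster:
  fixes G :: "('g, 'm) monoid_scheme"
  assumes G: "topological_group G TG" and H: "topological_group H TH" and T2: "Hausdorff_space TH"
    and f: "continuous_hom G TG H TH f"
  shows "h_complete G TG H TH f \<longleftrightarrow> (\<forall>F. og_filter G TG H TH f F \<longrightarrow> (\<exists>c. cluster_point TG F c))"
proof (intro iffI allI impI)
  fix F assume hc: "h_complete G TG H TH f" and F: "og_filter G TG H TH f F"
  from F obtain P :: "'g word monoid" and TP r \<phi> x where
    P: "topological_group P TP" "continuous_hom P TP H TH r" "continuous_hom G TG P TP \<phi>"
      "\<forall>g\<in>carrier G. f g = r (\<phi> g)" "x \<in> carrier P" and FP: "F = trace_filter G \<phi> TP x"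
    by (rule og_filterE)
  have x: "x \<in> topspace TP" using P by (simp add: topological_group.topspace_eq_carrier)
  have "x \<in> TP closure_of (\<phi> ` carrier G)"
    using F FP trace_filter_nontrivial_iff[OF x] by (auto simp: og_filter_def)
  then obtain c where c: "c \<in> carrier G" "\<And>U. openin TP U \<Longrightarrow> x \<in> U \<Longrightarrow> \<phi> c \<in> U"
    using h_complete_closure_point[OF hc G H T2 P(1-3)] P(4) by metis
  have "c \<in> A" if "\<forall>\<^sub>F g in F. g \<in> A" for A
    using that c by (auto simp: FP eventually_trace_filter[OF x])
  then have "cluster_point TG F c"
    using c(1) by (auto simp: cluster_point_def topological_group.topspace_eq_carrier[OF G])
  then show "\<exists>c. cluster_point TG F c" ..
next
  assume cl: "\<forall>F. og_filter G TG H TH f F \<longrightarrow> (\<exists>c. cluster_point TG F c)"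
  show "h_complete G TG H TH f"
    unfolding h_complete_def
  proof (intro allI impI, elim conjE)
    fix K :: "'g word monoid" and TK h k
    assume K: "topological_group K TK" and h: "continuous_hom G TG K TK h"
      and k: "continuous_hom K TK H TH k" and fkh: "\<forall>g\<in>carrier G. f g = k (h g)"
      and Hd: "fibrewise_Hausdorff TK k"
    note topG = topological_group.topspace_eq_carrier[OF G]
    note topK = topological_group.topspace_eq_carrier[OF K]
    have hK: "h g \<in> carrier K" if "g \<in> carrier G" for g
      using h that by (auto simp: continuous_hom_def hom_def)
    have "y \<in> h ` carrier G" if y: "y \<in> TK closure_of (h ` carrier G)" for y
    proof -
      have yK: "y \<in> topspace TK" using y by (simp add: in_closure_of)
      let ?F = "trace_filter G h TK y"
      have "og_filter G TG H TH f ?F"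
        using og_filter_trace_filter[OF G K k h, of f y] fkh yK
          trace_filter_nontrivial_iff[OF yK, THEN iffD2, OF y]
        by (simp add: topK)
      then obtain c where c: "c \<in> topspace TG" and nb: "inf ?F (nhdsin TG c) \<noteq> bot"
        using cl by (auto simp: cluster_point_iff_inf_nhdsin)
      \<comment> \<open>Both \<open>k y\<close> and \<open>f c\<close> are limits of
        \<open>f\<close> along the proper common refinement; uniqueness puts \<open>h c\<close> and
        \<open>y\<close> into one fibre of \<open>k\<close>.\<close>
      have "limitin TH f (k y) ?F"
        using k fkh hK yK by (intro limitin_trace_filter) (auto simp: continuous_hom_def topK)
      then have 1: "limitin TH f (k y) (inf ?F (nhdsin TG c))"
        by (rule limitin_filter_mono) simp
      have "limitin TH f (f c) (nhdsin TG c)"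
        unfolding limitin_def eventually_nhdsin
      \<comment> \<open>\<open>nhdsin\<close> is \<open>bot\<close> outside the space, so
        \<open>eventually_nhdsin\<close> is a disjunction; \<open>disjI2\<close> selects the case of
        genuine points.\<close>
      proof (intro conjI allI impI disjI2)
        show "f c \<in> topspace TH"
          using f c by (auto simp: continuous_hom_def continuous_map_def)
        fix U assume "openin TH U \<and> f c \<in> U"
        then show "\<exists>V. openin TG V \<and> c \<in> V \<and> (\<forall>z\<in>V. f z \<in> U)"
          using f c openin_continuous_map_preimage[of TG TH f U]
          by (intro exI[of _ "{z \<in> topspace TG. f z \<in> U}"]) (auto simp: continuous_hom_def)
      qed
      then have "limitin TH f (f c) (inf ?F (nhdsin TG c))"
        by (rule limitin_filter_mono) simp
      then have "k y = f c" by (rule limitin_Hausdorff_unique[OF 1 _ nb T2])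
      then have eq: "k (h c) = k y" using fkh c by (simp add: topG)
      have "h c = y"
      proof (rule ccontr)
        assume "h c \<noteq> y"
        then obtain U V where UV: "openin TK U" "openin TK V" "h c \<in> U" "y \<in> V" "disjnt U V"
          using Hd eq yK hK c unfolding fibrewise_Hausdorff_def by (metis topG topK)
        \<comment> \<open>Along the common refinement \<open>h\<close> would eventually lie in both
          of the disjoint sets \<open>U\<close> and \<open>V\<close>.\<close>
        have "\<forall>\<^sub>F g in ?F. h g \<in> V"
          using UV by (auto simp: eventually_trace_filter[OF yK])
        moreover have "openin TG {g \<in> topspace TG. h g \<in> U}"
          using h UV by (auto simp: continuous_hom_def intro: openin_continuous_map_preimage)
        then have "\<forall>\<^sub>F g in nhdsin TG c. h g \<in> U"
          unfolding eventually_nhdsin using c UV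
          by (intro disjI2 exI[of _ "{g \<in> topspace TG. h g \<in> U}"]) auto
        ultimately have "\<forall>\<^sub>F g in inf ?F (nhdsin TG c). False"
          unfolding eventually_inf using UV(5) by (auto simp: disjnt_iff)
        with nb show False by (simp add: trivial_limit_def)
      qed
      with c show ?thesis by (auto simp: topG)
    qed
    then have "TK closure_of (h ` carrier G) \<subseteq> h ` carrier G" by blast
    moreover have "h ` carrier G \<subseteq> topspace TK" using hK by (auto simp: topK)
    ultimately show "closedin TK (h ` carrier G)"
      using closure_of_subset_eq by blast
  qed
qed

theorem proposition4p9:
  fixes G :: "('g, 'm) monoid_scheme" and TG :: "'g topology"
    and H :: "('h, 'n) monoid_scheme" and TH :: "'h topology"
    and f :: "'g \<Rightarrow> 'h"
  assumes "topological_group G TG" and "topological_group H TH"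
    and "Hausdorff_space TH"
    and "continuous_hom G TG H TH f"
  shows "(h_complete G TG H TH f \<longleftrightarrow>
           (\<forall>F. og_filter G TG H TH f F \<longrightarrow> (\<exists>c. cluster_point TG F c)))
       \<and> (h_complete G TG H TH f \<longleftrightarrow>
           (\<forall>F. maximal_og_filter G TG H TH f F \<longrightarrow> (\<exists>c. filter_converges TG F c)))"
  using h_complete_iff_og_filters_cluster[OF assms] og_filters_cluster_iff_maximal_converge[OF assms]
  by blast

end
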